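(* Let $X$ be a finite-dimensional real normed space, let $\varphi: X\to[0,\infty)$ be a function, let $f: X\to(-\infty,\infty]$ have $\mathrm{dom}\,f\neq\emptyset$, and suppose that $(f\oplus\varphi)(x)>-\infty$ for all $x\in X$. Let $\bar x\in X$. Suppose that $\varphi$ is Fréchet strictly differentiable at every point of $X$ and that $\mathcal P$ is inner semicompact at $\bar x$. If $\mathcal P(\bar x)$ is a singleton, then $f\oplus\varphi$ is Fréchet strictly differentiable at $\bar x$ and $$\nabla(f\oplus\varphi)(\bar x)=-\nabla\varphi(\bar w-\bar x),$$ where $\bar w\in\mathcal P(\bar x)$.
   Context: $\mathrm{dom}\,f:=\{x\in X: f(x)<\infty\}$. The infimal convolution is $(f\oplus\varphi)(x):=\inf\{f(w)+\varphi(w-x): w\in X\}$ (note the argument $w-x$). The projection at $x$ is $\mathcal P(x):=\{w\in X: f(w)+\varphi(w-x)=(f\oplus\varphi)(x)\}$. $\mathcal P$ is inner semicompact at $\bar x$ if $\mathcal P(\bar x)\ne\emptyset$ and for every sequence $\{x_k\}\subset X$ converging to $\bar x$ there is a sequence $\{w_k\}$ with each $w_k\in\mathcal P(x_k)$ that contains a subsequence converging to some element of $\mathcal P(\bar x)$. A function $g$ is Fréchet strictly differentiable at $\bar x$ if there exists $v^*\in X^*$ with $\lim_{x,y\to\bar x,\,x\ne y}\frac{g(x)-g(y)-\langle v^*,x-y\rangle}{\|x-y\|}=0$; then $v^*$ is denoted $\nabla g(\bar x)$. *)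

theory Defs
  imports "HOL-Analysis.Analysis"
begin

definition effective_domain :: "('a \<Rightarrow> ereal) \<Rightarrow> 'a set" where
  "effective_domain f = {x. f x < \<infinity>}"

text \<open>The argument of \<open>\<phi>\<close> is \<open>w - x\<close>, not the more common \<open>x - w\<close>.\<close>

definition inf_conv ::
    "('a::real_normed_vector \<Rightarrow> ereal) \<Rightarrow> ('a \<Rightarrow> real) \<Rightarrow> 'a \<Rightarrow> ereal" where
  "inf_conv f \<phi> x = (INF w. f w + ereal (\<phi> (w - x)))"

definition proj_set ::
    "('a::real_normed_vector \<Rightarrow> ereal) \<Rightarrow> ('a \<Rightarrow> real) \<Rightarrow> 'a \<Rightarrow> 'a set" where
  "proj_set f \<phi> x = {w. f w + ereal (\<phi> (w - x)) = inf_conv f \<phi> x}"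

definition inner_semicompact ::
    "('a::topological_space \<Rightarrow> 'b::topological_space set) \<Rightarrow> 'a \<Rightarrow> bool" where
  "inner_semicompact P x0 \<longleftrightarrow>
     P x0 \<noteq> {} \<and>
     (\<forall>x :: nat \<Rightarrow> 'a. x \<longlonglongrightarrow> x0 \<longrightarrow>
        (\<exists>w. (\<forall>k. w k \<in> P (x k)) \<and>
             (\<exists>r :: nat \<Rightarrow> nat. strict_mono r \<and> (\<exists>l\<in>P x0. (w \<circ> r) \<longlonglongrightarrow> l))))"

definition has_strict_gradient ::
    "('a::real_normed_vector \<Rightarrow> real) \<Rightarrow> ('a \<Rightarrow>\<^sub>L real) \<Rightarrow> 'a \<Rightarrow> bool" where
  "has_strict_gradient g v x0 \<longleftrightarrow>
     ((\<lambda>(x, y). (g x - g y - blinfun_apply v (x - y)) / norm (x - y)) \<longlongrightarrow> 0)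
       (at (x0, x0) within {(x, y). x \<noteq> y})"

definition strictly_differentiable :: "('a::real_normed_vector \<Rightarrow> real) \<Rightarrow> 'a \<Rightarrow> bool" where
  "strictly_differentiable g x0 \<longleftrightarrow> (\<exists>v. has_strict_gradient g v x0)"

definition strict_gradient :: "('a::real_normed_vector \<Rightarrow> real) \<Rightarrow> 'a \<Rightarrow> 'a \<Rightarrow>\<^sub>L real" where
  "strict_gradient g x0 = (THE v. has_strict_gradient g v x0)"

lemma has_strict_gradient_unique:
  assumes "has_strict_gradient g v x0" and "has_strict_gradient g v' x0"
  shows "v = v'"
proof (rule blinfun_eqI)
  fix h
  show "blinfun_apply v h = blinfun_apply v' h"
  proof (cases "h = 0")
    case True
    then show ?thesis by (simp add: blinfun.zero_right)
  next
    case False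
    define p where "p = (\<lambda>n::nat. (x0 + (1 / real (Suc n)) *\<^sub>R h, x0))"
    have "(\<lambda>n. 1 / real (Suc n)) \<longlonglongrightarrow> 0"
      using LIMSEQ_inverse_real_of_nat by (simp add: inverse_eq_divide)
    then have "(\<lambda>n. x0 + (1 / real (Suc n)) *\<^sub>R h) \<longlonglongrightarrow> x0 + 0 *\<^sub>R h"
      by (intro tendsto_intros)
    then have "p \<longlonglongrightarrow> (x0, x0)"
      unfolding p_def by (intro tendsto_Pair) simp_all
    then have p: "filterlim p (at (x0, x0) within {(x, y). x \<noteq> y}) sequentially"
      using False by (auto simp: filterlim_at p_def)
    let ?q = "\<lambda>u (x, y). (g x - g y - blinfun_apply u (x - y)) / norm (x - y)"
    have "(\<lambda>n. ?q v (p n) - ?q v' (p n)) \<longlonglongrightarrow> 0 - 0"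
      using assms unfolding has_strict_gradient_def
      by (intro tendsto_diff filterlim_compose[OF _ p])
    moreover have "?q v (p n) - ?q v' (p n)
        = (blinfun_apply v' h - blinfun_apply v h) / norm h" for n
      using False
      by (simp add: p_def blinfun.scaleR_right diff_divide_distrib[symmetric] divide_simps)
    ultimately have "(\<lambda>n::nat. (blinfun_apply v' h - blinfun_apply v h) / norm h)
        \<longlonglongrightarrow> 0"
      by simp
    then show ?thesis
      using False by (simp add: LIMSEQ_const_iff)
  qed
qed

lemma strict_gradient_eqI:
  "has_strict_gradient g v x0 \<Longrightarrow> strict_gradient g x0 = v"
  unfolding strict_gradient_def using has_strict_gradient_unique by blast

text \<open>An infimal convolution that never takes the value \<open>-\<infinity>\<close> is finite everywhere, so
  \<open>real_of_ereal\<close> merely retypes it as a real-valued function.\<close>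

lemma ereal_real_of_inf_conv:
  assumes "effective_domain f \<noteq> {}" and "inf_conv f \<phi> x > -\<infinity>"
  shows "ereal (real_of_ereal (inf_conv f \<phi> x)) = inf_conv f \<phi> x"
proof -
  obtain w where w: "f w < \<infinity>"
    using assms(1) by (auto simp: effective_domain_def)
  have "inf_conv f \<phi> x \<le> f w + ereal (\<phi> (w - x))"
    unfolding inf_conv_def by (rule INF_lower) simp
  also have "\<dots> < \<infinity>"
    using w by simp
  finally have "inf_conv f \<phi> x < \<infinity>" .
  then show ?thesis
    using assms(2) by (intro ereal_real') auto
qed

end

theory Submission
  imports Defs
begin

text \<open>
  Write \<open>g\<close> for the (finite) infimal convolution. If \<open>w\<close> is a minimizer at \<open>y\<close>, it is still a
  competitor at any other point \<open>x\<close>, and the value \<open>f w\<close> cancels: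
  \<open>g x - g y \<le> \<phi> (w - x) - \<phi> (w - y)\<close> (\<open>inf_conv_diff_le\<close>). Thus increments of \<open>g\<close> are bounded
  above by increments of \<open>\<phi>\<close>, and near \<open>w0 - x0\<close> these are controlled by strict
  differentiability, as long as \<open>w\<close> can be chosen close to \<open>w0\<close>. Such a choice exists because
  inner semicompactness, when the projection at \<open>x0\<close> is the single point \<open>w0\<close>, forces all
  nearby points to have a projection near \<open>w0\<close> (\<open>inner_semicompact_eventually_meets\<close>).

  An upper bound is enough: strict differentiability compares two points that play
  interchangeable roles, so exchanging \<open>x\<close> and \<open>y\<close> turns the upper estimate into the lower one
  (\<open>has_strict_gradient_iff_upper\<close>). The minus sign in the gradient comes from \<open>x\<close> entering \<open>\<phi>\<close>
  through \<open>w - x\<close>.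
\<close>

text \<open>The absolute value in the definition of the limit may be dropped, since the remainder
  \<open>g x - g y - v (x - y)\<close> changes sign when \<open>x\<close> and \<open>y\<close> are exchanged.\<close>

lemma has_strict_gradient_iff_upper:
  "has_strict_gradient g v x0 \<longleftrightarrow>
     (\<forall>e>0. \<exists>d>0. \<forall>x y. dist x x0 < d \<longrightarrow> dist y x0 < d \<longrightarrow>
        g x - g y - blinfun_apply v (x - y) \<le> e * norm (x - y))"
  (is "_ \<longleftrightarrow> ?R")
proof
  assume L: "has_strict_gradient g v x0"
  show ?R
  proof (intro allI impI)
    fix e :: real assume "e > 0"
    with L obtain d where "d > 0" and d:
      "\<And>p. \<lbrakk>fst p \<noteq> snd p; p \<noteq> (x0, x0); dist p (x0, x0) < d\<rbrakk> \<Longrightarrow>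
        \<bar>(g (fst p) - g (snd p) - blinfun_apply v (fst p - snd p)) / norm (fst p - snd p)\<bar> < e"
      unfolding has_strict_gradient_def tendsto_iff eventually_at
      by (force simp: case_prod_beta dist_real_def)
    show "\<exists>d>0. \<forall>x y. dist x x0 < d \<longrightarrow> dist y x0 < d \<longrightarrow>
        g x - g y - blinfun_apply v (x - y) \<le> e * norm (x - y)"
    proof (intro exI[of _ "d / 2"] conjI allI impI)
      fix x y assume xy: "dist x x0 < d / 2" "dist y x0 < d / 2"
      show "g x - g y - blinfun_apply v (x - y) \<le> e * norm (x - y)"
      proof (cases "x = y")
        case False
        have "dist (x, y) (x0, x0) \<le> dist x x0 + dist y x0"
          by (simp add: dist_Pair_Pair sqrt_sum_squares_le_sum)
        then have "dist (x, y) (x0, x0) < d" using xy by linarith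
        then have "\<bar>(g x - g y - blinfun_apply v (x - y)) / norm (x - y)\<bar> < e"
          using d[of "(x, y)"] False by auto
        then have "(g x - g y - blinfun_apply v (x - y)) / norm (x - y) < e" by linarith
        then show ?thesis using False by (simp add: divide_less_eq)
      qed simp
    qed (use \<open>d > 0\<close> in simp)
  qed
next
  assume R: ?R
  show "has_strict_gradient g v x0"
    unfolding has_strict_gradient_def tendsto_iff
  proof (intro allI impI)
    fix e :: real assume "e > 0"
    with R obtain d where "d > 0" and d:
      "\<And>x y. \<lbrakk>dist x x0 < d; dist y x0 < d\<rbrakk> \<Longrightarrow>
        g x - g y - blinfun_apply v (x - y) \<le> e / 2 * norm (x - y)"
      by (metis half_gt_zero)
    have "\<bar>(g x - g y - blinfun_apply v (x - y)) / norm (x - y)\<bar> < e"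
      if xy: "x \<noteq> y" "dist (x, y) (x0, x0) < d" for x y
    proof -
      have near: "dist x x0 < d" "dist y x0 < d"
        using xy(2) dist_fst_le[of "(x, y)" "(x0, x0)"] dist_snd_le[of "(x, y)" "(x0, x0)"]
        by auto
      have "\<bar>g x - g y - blinfun_apply v (x - y)\<bar> \<le> e / 2 * norm (x - y)"
        using d[OF near] d[OF near(2,1)]
        unfolding blinfun.diff_right norm_minus_commute[of y x] by linarith
      also have "\<dots> < e * norm (x - y)" using xy(1) \<open>e > 0\<close> by simp
      finally show ?thesis using xy(1) by (simp add: divide_less_eq)
    qed
    then show "\<forall>\<^sub>F p in at (x0, x0) within {(x, y). x \<noteq> y}.
        dist (case p of (x, y) \<Rightarrow> (g x - g y - blinfun_apply v (x - y)) / norm (x - y)) 0 < e"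
      unfolding eventually_at using \<open>d > 0\<close> by (auto simp: dist_real_def)
  qed
qed

text \<open>Otherwise there would be a sequence converging to \<open>x0\<close> along which the values of \<open>P\<close> miss
  \<open>U\<close>, whereas some selection of those values accumulates at a point of \<open>P x0\<close>, hence inside
  \<open>U\<close>.\<close>

lemma inner_semicompact_eventually_meets:
  fixes P :: "'a::first_countable_topology \<Rightarrow> 'b::topological_space set"
  assumes P: "inner_semicompact P x0" and U: "open U" "P x0 \<subseteq> U"
  shows "\<forall>\<^sub>F x in nhds x0. P x \<inter> U \<noteq> {}"
proof (rule ccontr)
  assume "\<not> ?thesis"
  then obtain z where z: "z \<longlonglongrightarrow> x0" "\<not> (\<forall>\<^sub>F n in sequentially. P (z n) \<inter> U \<noteq> {})"
    unfolding eventually_nhds_iff_sequentially by blast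
  then obtain s :: "nat \<Rightarrow> nat" where s: "strict_mono s" "\<And>n. P (z (s n)) \<inter> U = {}"
    using not_eventually_sequentiallyD by blast
  define x where "x = z \<circ> s"
  have x: "x \<longlonglongrightarrow> x0" "\<And>n. P (x n) \<inter> U = {}"
    using LIMSEQ_subseq_LIMSEQ[OF z(1) s(1)] s(2) by (simp_all add: x_def)
  obtain w r l where w: "\<And>k. w k \<in> P (x k)" and l: "l \<in> P x0" "(w \<circ> r) \<longlonglongrightarrow> l"
    using P x(1) unfolding inner_semicompact_def by meson
  have "\<forall>\<^sub>F n in sequentially. (w \<circ> r) n \<in> U"
    using topological_tendstoD[OF l(2) U(1)] l(1) U(2) by blast
  then obtain n where "w (r n) \<in> U"
    using eventually_happens[of _ sequentially] by force
  with w[of "r n"] x(2)[of "r n"] show False by blast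
qed

text \<open>A minimizer at \<open>y\<close> competes at \<open>x\<close>; its value \<open>f w\<close> is finite and cancels.\<close>

lemma inf_conv_diff_le:
  assumes dom: "effective_domain f \<noteq> {}"
    and fin: "\<And>z. inf_conv f \<phi> z > -\<infinity>"
    and w: "w \<in> proj_set f \<phi> y"
  shows "real_of_ereal (inf_conv f \<phi> x) - real_of_ereal (inf_conv f \<phi> y)
      \<le> \<phi> (w - x) - \<phi> (w - y)"
proof -
  let ?g = "\<lambda>z. real_of_ereal (inf_conv f \<phi> z)"
  have g: "ereal (?g z) = inf_conv f \<phi> z" for z
    by (rule ereal_real_of_inf_conv[OF dom fin])
  have y: "f w + ereal (\<phi> (w - y)) = ereal (?g y)"
    using w by (simp add: proj_set_def g)
  have x: "ereal (?g x) \<le> f w + ereal (\<phi> (w - x))"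
    unfolding g unfolding inf_conv_def by (rule INF_lower) simp
  show ?thesis
    using x y by (cases "f w") auto
qed

theorem proposition6p4:
  fixes f :: "'a::real_normed_vector \<Rightarrow> ereal"
    and \<phi> :: "'a \<Rightarrow> real"
    and x0 w0 :: 'a
  assumes finite_dim: "\<exists>B :: 'a set. finite B \<and> span B = UNIV"
    and phi_nonneg: "\<And>x. \<phi> x \<ge> 0"
    and f_gt_MInf: "\<And>x. f x > -\<infinity>"
    and dom_nonempty: "effective_domain f \<noteq> {}"
    and conv_gt_MInf: "\<And>x. inf_conv f \<phi> x > -\<infinity>"
    and phi_diff: "\<And>x. strictly_differentiable \<phi> x"
    and semicompact: "inner_semicompact (proj_set f \<phi>) x0"
    and singleton: "is_singleton (proj_set f \<phi> x0)"
    and w0: "w0 \<in> proj_set f \<phi> x0"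
  shows "strictly_differentiable (\<lambda>x. real_of_ereal (inf_conv f \<phi> x)) x0 \<and>
         strict_gradient (\<lambda>x. real_of_ereal (inf_conv f \<phi> x)) x0 = - strict_gradient \<phi> (w0 - x0)"
proof -
  let ?g = "\<lambda>x. real_of_ereal (inf_conv f \<phi> x)"
  obtain v where v: "has_strict_gradient \<phi> v (w0 - x0)"
    using phi_diff unfolding strictly_differentiable_def by blast
  have proj: "proj_set f \<phi> x0 = {w0}"
    using singleton w0 by (auto simp: is_singleton_def)
  have "has_strict_gradient ?g (- v) x0"
    unfolding has_strict_gradient_iff_upper
  proof (intro allI impI)
    fix e :: real assume "e > 0"
    with v obtain d where "d > 0" and d:
      "\<And>a b. \<lbrakk>dist a (w0 - x0) < d; dist b (w0 - x0) < d\<rbrakk> \<Longrightarrow>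
        \<phi> a - \<phi> b - blinfun_apply v (a - b) \<le> e * norm (a - b)"
      unfolding has_strict_gradient_iff_upper by blast
    \<comment> \<open>The argument \<open>w - x\<close> of \<open>\<phi>\<close> moves by at most the sum of the displacements of \<open>w\<close> and \<open>x\<close>,
        so each of them is granted half of \<open>d\<close>.\<close>
    have "\<forall>\<^sub>F y in nhds x0. proj_set f \<phi> y \<inter> ball w0 (d / 2) \<noteq> {}"
      using \<open>d > 0\<close> by (intro inner_semicompact_eventually_meets[OF semicompact]) (auto simp: proj)
    then obtain r where "r > 0" and r:
      "\<And>y. dist y x0 < r \<Longrightarrow> \<exists>w\<in>proj_set f \<phi> y. dist w w0 < d / 2"
      unfolding eventually_nhds_metric by (fastforce simp: dist_commute)
    show "\<exists>d>0. \<forall>x y. dist x x0 < d \<longrightarrow> dist y x0 < d \<longrightarrow>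
        ?g x - ?g y - blinfun_apply (- v) (x - y) \<le> e * norm (x - y)"
    proof (intro exI[of _ "min r (d / 2)"] conjI allI impI)
      fix x y assume x: "dist x x0 < min r (d / 2)" and y: "dist y x0 < min r (d / 2)"
      obtain w where w: "w \<in> proj_set f \<phi> y" "dist w w0 < d / 2"
        using r y by force
      have near: "dist (w - z) (w0 - x0) < d" if "dist z x0 < min r (d / 2)" for z
        using that w(2) norm_triangle_ineq4[of "w - w0" "z - x0"]
        by (simp add: dist_norm algebra_simps)
      have "?g x - ?g y \<le> \<phi> (w - x) - \<phi> (w - y)"
        by (rule inf_conv_diff_le[OF dom_nonempty conv_gt_MInf w(1)])
      also have "\<dots> \<le> blinfun_apply v (y - x) + e * norm (y - x)"
        using d[OF near[OF x] near[OF y]] by simp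
      finally show "?g x - ?g y - blinfun_apply (- v) (x - y) \<le> e * norm (x - y)"
        by (simp add: blinfun.minus_left blinfun.diff_right norm_minus_commute)
    qed (use \<open>r > 0\<close> \<open>d > 0\<close> in simp)
  qed
  then show ?thesis
    using strict_gradient_eqI[OF v] strict_gradient_eqI
    by (auto simp: strictly_differentiable_def)
qed

end
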